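(* A finite directed connected graph $X$ is obtained by the recursive process described in the context (i.e. $X$ is isomorphic to some $X_k$ in a sequence $X_0,X_1,\dots,X_k$ where $X_0$ is a cycle $c_n$ and each $X_{i+1}$ is obtained from $X_i$ by identifying two nodes of $X_i$ or by attaching a cycle to a node of $X_i$) if and only if for every node $x$ of $X$ the in degree and the out degree of $x$ are equal.
   Context: A directed graph $X$ consists of a set $X(0)$ of nodes, a set $X(1)$ of arcs, and two maps $s,t:X(1)\to X(0)$ (source and target); loops and parallel arcs are allowed. The in degree of a node $x$ is the number of arcs with target $x$; the out degree is the number of arcs with source $x$. For $n\ge 1$, $c_n$ is the directed cycle with $n$ nodes $x_0,\dots,x_{n-1}$ and $n$ arcs $a_i$ from $x_i$ to $x_{i+1}$ (indices mod $n$); the graph $c_0$ with one node and no arc is called the cycle of length $0$. A path from $x$ to $y$ in $X$ is a finite sequence of consecutive arcs from $x$ to $y$ (a morphism from a directed path graph; the trivial path with one node and no arc is allowed). $X$ is connected if for all nodes $x,y$ of $X$ there are nodes $x_1=x,x_2,\dots,x_l=y$ such that for each $i<l$ there is a path from $x_i$ to $x_{i+1}$ or a path from $x_{i+1}$ to $x_i$. The process: $X_0$ is a cycle $c_n$. Given $X_i$, the graph $X_{i+1}$ is obtained either by identifying two nodes of $X_i$ (taking the quotient of the node set that identifies these two nodes, the set of arcs being unchanged), or by attaching a cycle to a node of $X_i$ (taking the disjoint union of $X_i$ and some cycle $c_m$ and identifying a node of $c_m$ with a node of $X_i$). *)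

theory Defs
  imports "Graph_Theory.Graph_Theory"
begin

text \<open>
  Directed graphs with loops and parallel arcs are the \<open>pre_digraph\<close>s of the AFP entry
  \<open>Graph_Theory\<close> (source = \<open>tail\<close>, target = \<open>head\<close>) that satisfy \<open>wf_digraph\<close>; degrees and
  isomorphisms are the ones of that entry. A path in the sense used here (nodes and arcs may be
  repeated, the empty arc sequence is allowed) is the library's \<open>awalk\<close>, not its \<open>apath\<close>.
\<close>

definition joined_by_path :: "('a,'b) pre_digraph \<Rightarrow> 'a \<Rightarrow> 'a \<Rightarrow> bool" where
  "joined_by_path G x y \<longleftrightarrow> (\<exists>p. pre_digraph.awalk G x p y)"

text \<open>
  Unlike the library's \<open>connected\<close>, this holds for the graph without nodes; see
  \<open>connected_iff_zigzag_connected\<close> below.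
\<close>
definition zigzag_connected :: "('a,'b) pre_digraph \<Rightarrow> bool" where
  "zigzag_connected G \<longleftrightarrow>
     (\<forall>x\<in>verts G. \<forall>y\<in>verts G. \<exists>xs. xs \<noteq> [] \<and> set xs \<subseteq> verts G \<and> hd xs = x \<and> last xs = y \<and>
        (\<forall>i. Suc i < length xs \<longrightarrow>
           joined_by_path G (xs ! i) (xs ! Suc i) \<or> joined_by_path G (xs ! Suc i) (xs ! i)))"

text \<open>For \<open>n = 0\<close> this is the graph with the single node 0 and no arc.\<close>
definition cycle_graph :: "nat \<Rightarrow> (nat, nat) pre_digraph" where
  "cycle_graph n =
     \<lparr>verts = (if n = 0 then {0} else {..<n}), arcs = {..<n},
      tail = (\<lambda>i. i), head = (\<lambda>i. Suc i mod n)\<rparr>"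

definition disjoint_union ::
    "('a,'b) pre_digraph \<Rightarrow> ('c,'d) pre_digraph \<Rightarrow> ('a + 'c, 'b + 'd) pre_digraph" where
  "disjoint_union G H =
     \<lparr>verts = verts G <+> verts H, arcs = arcs G <+> arcs H,
      tail = map_sum (tail G) (tail H), head = map_sum (head G) (head H)\<rparr>"

definition identification :: "('a,'b) pre_digraph \<Rightarrow> 'a \<Rightarrow> 'a \<Rightarrow> ('a \<times> 'a) set" where
  "identification G u v =
     {(x, y). x \<in> verts G \<and> y \<in> verts G \<and> (x = y \<or> {x, y} = {u, v})}"

text \<open>The nodes of the quotient are the equivalence classes; the arcs are unchanged.\<close>
definition identify_nodes :: "('a,'b) pre_digraph \<Rightarrow> 'a \<Rightarrow> 'a \<Rightarrow> ('a set, 'b) pre_digraph" where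
  "identify_nodes G u v =
     \<lparr>verts = verts G // identification G u v, arcs = arcs G,
      tail = (\<lambda>a. identification G u v `` {tail G a}),
      head = (\<lambda>a. identification G u v `` {head G a})\<rparr>"

text \<open>The node \<open>w\<close> of the \<open>m\<close>-cycle is glued to the node \<open>u\<close> of \<open>G\<close>.\<close>
definition attach_cycle ::
    "('a,'b) pre_digraph \<Rightarrow> 'a \<Rightarrow> nat \<Rightarrow> nat \<Rightarrow> (('a + nat) set, 'b + nat) pre_digraph" where
  "attach_cycle G u m w = identify_nodes (disjoint_union G (cycle_graph m)) (Inl u) (Inr w)"

text \<open>
  Quotients and disjoint unions change the type of the nodes and arcs. To iterate them, every
  intermediate graph is taken up to isomorphism with nodes and arcs in \<open>nat\<close>, which loses nothing
  because all graphs that occur are finite.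
\<close>
inductive construction_step :: "(nat, nat) pre_digraph \<Rightarrow> (nat, nat) pre_digraph \<Rightarrow> bool" where
  identify: "\<lbrakk>u \<in> verts G; v \<in> verts G; u \<noteq> v; digraph_iso (identify_nodes G u v) H\<rbrakk>
    \<Longrightarrow> construction_step G H"
| attach: "\<lbrakk>u \<in> verts G; w \<in> verts (cycle_graph m); digraph_iso (attach_cycle G u m w) H\<rbrakk>
    \<Longrightarrow> construction_step G H"

definition obtained_from_cycle :: "('a,'b) pre_digraph \<Rightarrow> bool" where
  "obtained_from_cycle X \<longleftrightarrow>
     (\<exists>(k::nat) (Xs :: nat \<Rightarrow> (nat, nat) pre_digraph).
        (\<exists>n. Xs 0 = cycle_graph n) \<and>
        (\<forall>i<k. construction_step (Xs i) (Xs (Suc i))) \<and>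
        digraph_iso X (Xs k))"

lemma wf_cycle_graph: "wf_digraph (cycle_graph n)"
  by unfold_locales (auto simp: cycle_graph_def)

lemma wf_disjoint_union:
  assumes "wf_digraph G" "wf_digraph H"
  shows "wf_digraph (disjoint_union G H)"
proof -
  interpret G: wf_digraph G by fact
  interpret H: wf_digraph H by fact
  show ?thesis by unfold_locales (auto simp: disjoint_union_def)
qed

lemma equiv_identification:
  "u \<in> verts G \<Longrightarrow> v \<in> verts G \<Longrightarrow> equiv (verts G) (identification G u v)"
  by (rule equivI; force simp: identification_def doubleton_eq_iff intro!: refl_onI symI transI)

lemma wf_identify_nodes:
  assumes "wf_digraph G"
  shows "wf_digraph (identify_nodes G u v)"
proof -
  interpret G: wf_digraph G by fact
  show ?thesis by unfold_locales (auto simp: identify_nodes_def intro: quotientI)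
qed

lemma connected_iff_zigzag_connected:
  assumes "wf_digraph G"
  shows "connected G \<longleftrightarrow> verts G \<noteq> {} \<and> zigzag_connected G"
proof -
  interpret G: wf_digraph G by fact
  interpret S: pair_wf_digraph "mk_symmetric G" by (rule G.wellformed_mk_symmetric)
  let ?S = "with_proj (mk_symmetric G)"
  have path: "joined_by_path G x y \<longleftrightarrow> x \<rightarrow>\<^sup>*\<^bsub>G\<^esub> y" for x y
    by (simp add: joined_by_path_def G.reachable_awalk)
  have sym: "x \<rightarrow>\<^sup>*\<^bsub>?S\<^esub> y \<Longrightarrow> y \<rightarrow>\<^sup>*\<^bsub>?S\<^esub> x" for x y
    by (rule symmetric_reachable[rotated], assumption)
       (auto simp: symmetric_def sym_def parcs_mk_symmetric arcs_ends_conv)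
  have zigzag: "\<exists>xs. xs \<noteq> [] \<and> set xs \<subseteq> verts G \<and> hd xs = x \<and> last xs = y \<and>
      (\<forall>i. Suc i < length xs \<longrightarrow>
         joined_by_path G (xs ! i) (xs ! Suc i) \<or> joined_by_path G (xs ! Suc i) (xs ! i))"
    if "x \<rightarrow>\<^sup>*\<^bsub>?S\<^esub> y" for x y
    using that
  proof (induction rule: S.converse_reachable_induct)
    case base
    then show ?case by (intro exI[of _ "[y]"]) simp
  next
    case (step x z)
    then obtain xs where xs: "xs \<noteq> []" "set xs \<subseteq> verts G" "hd xs = z" "last xs = y"
      "\<And>i. Suc i < length xs \<Longrightarrow>
         joined_by_path G (xs ! i) (xs ! Suc i) \<or> joined_by_path G (xs ! Suc i) (xs ! i)"
      by blast
    from step(1) have e: "x \<rightarrow>\<^bsub>G\<^esub> z \<or> z \<rightarrow>\<^bsub>G\<^esub> x"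
      by (auto simp: parcs_mk_symmetric arcs_ends_conv)
    then have "x \<in> verts G" by auto
    moreover from e have "joined_by_path G x z \<or> joined_by_path G z x"
      unfolding path by blast
    then have "joined_by_path G ((x # xs) ! i) ((x # xs) ! Suc i) \<or>
        joined_by_path G ((x # xs) ! Suc i) ((x # xs) ! i)" if "Suc i < length (x # xs)" for i
      using that xs(1,3,5) by (cases i) (auto simp: hd_conv_nth)
    ultimately show ?case using xs(1,2,4) by (intro exI[of _ "x # xs"]) auto
  qed
  have reach: "hd xs \<rightarrow>\<^sup>*\<^bsub>?S\<^esub> last xs"
    if "xs \<noteq> []" "set xs \<subseteq> verts G"
      "\<forall>i. Suc i < length xs \<longrightarrow>
         joined_by_path G (xs ! i) (xs ! Suc i) \<or> joined_by_path G (xs ! Suc i) (xs ! i)" for xs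
    using that
  proof (induction xs rule: list_nonempty_induct)
    case (single x)
    then show ?case by simp
  next
    case (cons x xs)
    have "joined_by_path G x (hd xs) \<or> joined_by_path G (hd xs) x"
      using cons.prems(2)[rule_format, of 0] \<open>xs \<noteq> []\<close> by (simp add: hd_conv_nth)
    then have "x \<rightarrow>\<^sup>*\<^bsub>?S\<^esub> hd xs"
      unfolding path by (auto dest: G.reachable_mk_symmetricI sym)
    moreover have "hd xs \<rightarrow>\<^sup>*\<^bsub>?S\<^esub> last xs"
    proof (rule cons.IH)
      show "set xs \<subseteq> verts G" using cons.prems(1) by simp
      show "\<forall>i. Suc i < length xs \<longrightarrow>
          joined_by_path G (xs ! i) (xs ! Suc i) \<or> joined_by_path G (xs ! Suc i) (xs ! i)"
      proof (intro allI impI)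
        fix i assume "Suc i < length xs"
        then show "joined_by_path G (xs ! i) (xs ! Suc i) \<or> joined_by_path G (xs ! Suc i) (xs ! i)"
          using cons.prems(2)[rule_format, of "Suc i"] by simp
      qed
    qed
    ultimately show ?case using \<open>xs \<noteq> []\<close> by (auto intro: S.reachable_trans)
  qed
  show ?thesis
  proof
    assume "connected G"
    then have "verts G \<noteq> {}" "\<And>x y. x \<in> verts G \<Longrightarrow> y \<in> verts G \<Longrightarrow> x \<rightarrow>\<^sup>*\<^bsub>?S\<^esub> y"
      by (auto simp: connected_def strongly_connected_def)
    then show "verts G \<noteq> {} \<and> zigzag_connected G"
      unfolding zigzag_connected_def using zigzag by simp
  next
    assume A: "verts G \<noteq> {} \<and> zigzag_connected G"
    have "x \<rightarrow>\<^sup>*\<^bsub>?S\<^esub> y" if xy: "x \<in> verts G" "y \<in> verts G" for x y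
    proof -
      from A xy obtain xs where "xs \<noteq> []" "set xs \<subseteq> verts G" "hd xs = x" "last xs = y"
        "\<forall>i. Suc i < length xs \<longrightarrow>
           joined_by_path G (xs ! i) (xs ! Suc i) \<or> joined_by_path G (xs ! Suc i) (xs ! i)"
        unfolding zigzag_connected_def by blast
      with reach[of xs] show ?thesis by simp
    qed
    with A show "connected G" by (simp add: connected_def strongly_connected_def)
  qed
qed

end

theory Submission
  imports Defs
begin

text \<open>
  Identifying nodes adds up in degrees and out degrees, so the process preserves their equality.
  Conversely, an Euler circuit with \<open>n\<close> arcs exhibits the graph as a quotient of the cycle
  \<open>c\<^sub>n\<close> on its nodes, and this quotient is reached by identifying two nodes at a time; attaching
  cycles is not even needed.
\<close>

section \<open>Quotient maps between graphs\<close>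

text \<open>One notion covers isomorphisms, single identifications and the map from a cycle onto an
  Eulerian graph. The maps are explicit because the types of nodes and arcs change along the
  way.\<close>

definition node_quotient ::
    "('a \<Rightarrow> 'c) \<Rightarrow> ('b \<Rightarrow> 'd) \<Rightarrow> ('a,'b) pre_digraph \<Rightarrow> ('c,'d) pre_digraph \<Rightarrow> bool" where
  "node_quotient f g G H \<longleftrightarrow>
     f ` verts G = verts H \<and> bij_betw g (arcs G) (arcs H) \<and>
     (\<forall>a\<in>arcs G. tail H (g a) = f (tail G a) \<and> head H (g a) = f (head G a))"

lemma digraph_iso_iff_node_quotient:
  "digraph_iso G H \<longleftrightarrow> wf_digraph G \<and> (\<exists>f g. node_quotient f g G H \<and> inj_on f (verts G))"
proof
  assume "digraph_iso G H"
  then obtain h where "pre_digraph.digraph_isomorphism G h" "H = app_iso h G"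
    unfolding digraph_iso_def by blast
  then have "wf_digraph G" "node_quotient (iso_verts h) (iso_arcs h) G H"
    "inj_on (iso_verts h) (verts G)"
    by (auto simp: pre_digraph.digraph_isomorphism_def node_quotient_def bij_betw_def)
  then show "wf_digraph G \<and> (\<exists>f g. node_quotient f g G H \<and> inj_on f (verts G))"
    by blast
next
  assume "wf_digraph G \<and> (\<exists>f g. node_quotient f g G H \<and> inj_on f (verts G))"
  then obtain f g where fg: "wf_digraph G" "node_quotient f g G H" "inj_on f (verts G)"
    by blast
  \<comment> \<open>An isomorphism record also carries the end maps of its image. Taking those of
    \<open>H\<close> makes \<open>H\<close> equal to the image even where \<open>tail\<close> and
    \<open>head\<close> are applied outside the arcs.\<close>
  let ?h = "\<lparr>iso_verts = f, iso_arcs = g, iso_head = head H, iso_tail = tail H\<rparr>"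
  from fg have "pre_digraph.digraph_isomorphism G ?h"
    by (auto simp: pre_digraph.digraph_isomorphism_def node_quotient_def bij_betw_def)
  moreover from fg have "H = app_iso ?h G"
    by (intro pre_digraph.equality) (auto simp: node_quotient_def bij_betw_def)
  ultimately show "digraph_iso G H"
    unfolding digraph_iso_def by blast
qed

lemma digraph_iso_sym:
  assumes "digraph_iso G H"
  shows "digraph_iso H G"
proof -
  from assms obtain h where h: "wf_digraph G" "pre_digraph.digraph_isomorphism G h" "H = app_iso h G"
    by (auto simp: digraph_iso_def pre_digraph.digraph_isomorphism_def)
  then show ?thesis
    unfolding digraph_iso_def
    using wf_digraph.digraph_isomorphism_invI pre_digraph.app_iso_inv by metis
qed

lemma node_quotient_identify_nodes:
  "node_quotient (\<lambda>x. identification G u v `` {x}) id G (identify_nodes G u v)"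
  by (auto simp: node_quotient_def identify_nodes_def quotient_def)

section \<open>Invariance of balance under the process\<close>

text \<open>Finiteness is bundled in because degrees are cardinalities, which add up over merged
  nodes only for finite sets.\<close>

definition balanced_digraph :: "('a,'b) pre_digraph \<Rightarrow> bool" where
  "balanced_digraph G \<longleftrightarrow> fin_digraph G \<and> (\<forall>x\<in>verts G. in_degree G x = out_degree G x)"

text \<open>The arcs at \<open>y\<close> are the images of the arcs at the nodes of the fibre of
  \<open>f\<close> over \<open>y\<close>, and these arc sets are disjoint. Since \<open>e\<close>
  may be \<open>tail\<close> or \<open>head\<close>, both kinds of degree are served.\<close>

lemma card_fibre_image:
  assumes "finite A" "finite V" "e ` A \<subseteq> V" "inj_on g A"
    and "\<And>a. a \<in> A \<Longrightarrow> e' (g a) = f (e a)"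
  shows "card {b \<in> g ` A. e' b = y} = (\<Sum>x | x \<in> V \<and> f x = y. card {a \<in> A. e a = x})"
proof -
  have "{b \<in> g ` A. e' b = y} = g ` (\<Union>x\<in>{x \<in> V. f x = y}. {a \<in> A. e a = x})"
    using assms(3,5) by auto
  then have "card {b \<in> g ` A. e' b = y} = card (\<Union>x\<in>{x \<in> V. f x = y}. {a \<in> A. e a = x})"
    using card_image[OF inj_on_subset[OF assms(4)]] by (smt (verit) UN_iff mem_Collect_eq subsetI)
  also have "\<dots> = (\<Sum>x | x \<in> V \<and> f x = y. card {a \<in> A. e a = x})"
    by (rule card_UN_disjoint) (use assms(1,2) in auto)
  finally show ?thesis .
qed

lemma balanced_digraph_node_quotient:
  assumes "balanced_digraph G" and q: "node_quotient f g G H"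
  shows "balanced_digraph H"
proof -
  interpret G: fin_digraph G using assms(1) by (simp add: balanced_digraph_def)
  have arcs: "arcs H = g ` arcs G" and inj: "inj_on g (arcs G)" and verts: "verts H = f ` verts G"
    and ends: "\<And>a. a \<in> arcs G \<Longrightarrow> tail H (g a) = f (tail G a)"
      "\<And>a. a \<in> arcs G \<Longrightarrow> head H (g a) = f (head G a)"
    using q by (auto simp: node_quotient_def bij_betw_def)
  have "fin_digraph H"
    by unfold_locales (auto simp: arcs verts ends)
  moreover have "in_degree H y = out_degree H y" for y
  proof -
    have "in_degree H y = (\<Sum>x | x \<in> verts G \<and> f x = y. in_degree G x)"
      unfolding in_degree_def in_arcs_def arcs
      by (rule card_fibre_image) (auto simp: inj ends)
    also have "\<dots> = (\<Sum>x | x \<in> verts G \<and> f x = y. out_degree G x)"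
      using assms(1) by (intro sum.cong) (auto simp: balanced_digraph_def)
    also have "\<dots> = out_degree H y"
      unfolding out_degree_def out_arcs_def arcs
      by (rule card_fibre_image[symmetric]) (auto simp: inj ends)
    finally show ?thesis .
  qed
  ultimately show ?thesis by (simp add: balanced_digraph_def)
qed

lemma balanced_digraph_iso:
  "balanced_digraph G \<Longrightarrow> digraph_iso G H \<Longrightarrow> balanced_digraph H"
  by (auto simp: digraph_iso_iff_node_quotient intro: balanced_digraph_node_quotient)

lemma balanced_cycle_graph: "balanced_digraph (cycle_graph n)"
proof -
  interpret wf_digraph "cycle_graph n" by (rule wf_cycle_graph)
  have "fin_digraph (cycle_graph n)"
    by unfold_locales (auto simp: cycle_graph_def)
  moreover have "in_degree (cycle_graph n) x = out_degree (cycle_graph n) x"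
    if "x \<in> verts (cycle_graph n)" for x
  proof (cases "n = 0")
    case True
    then show ?thesis by (simp add: in_degree_def out_degree_def in_arcs_def out_arcs_def cycle_graph_def)
  next
    case False
    with that have x: "x < n" by (simp add: cycle_graph_def)
    have "out_arcs (cycle_graph n) x = {x}"
      using x by (auto simp: cycle_graph_def)
    \<comment> \<open>The arc entering node 0 is the last one; for \<open>n = 1\<close> this is the
      loop 0 itself.\<close>
    moreover have "in_arcs (cycle_graph n) x = {if x = 0 then n - 1 else x - 1}"
      using x by (auto simp: cycle_graph_def mod_Suc split: if_splits)
    ultimately show ?thesis by (simp add: in_degree_def out_degree_def)
  qed
  ultimately show ?thesis by (simp add: balanced_digraph_def)
qed

lemma balanced_disjoint_union:
  assumes "balanced_digraph G" "balanced_digraph H"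
  shows "balanced_digraph (disjoint_union G H)"
proof -
  interpret G: fin_digraph G using assms(1) by (simp add: balanced_digraph_def)
  interpret H: fin_digraph H using assms(2) by (simp add: balanced_digraph_def)
  let ?U = "disjoint_union G H"
  interpret U: wf_digraph ?U
    by (rule wf_disjoint_union) unfold_locales
  have "fin_digraph ?U"
    by unfold_locales (auto simp: disjoint_union_def)
  moreover have "in_arcs ?U (Inl x) = Inl ` in_arcs G x" "out_arcs ?U (Inl x) = Inl ` out_arcs G x"
    for x by (auto simp: disjoint_union_def)
  moreover have "in_arcs ?U (Inr x) = Inr ` in_arcs H x" "out_arcs ?U (Inr x) = Inr ` out_arcs H x"
    for x by (auto simp: disjoint_union_def)
  ultimately show ?thesis
    using assms by (auto simp: balanced_digraph_def in_degree_def out_degree_def card_image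
        disjoint_union_def)
qed

text \<open>Attaching a cycle is itself an identification, performed in a disjoint union of balanced
  graphs, so both rules reduce to quotients.\<close>

lemma balanced_construction_step:
  "construction_step G H \<Longrightarrow> balanced_digraph G \<Longrightarrow> balanced_digraph H"
  by (induction rule: construction_step.induct)
     (auto simp: attach_cycle_def elim!: balanced_digraph_iso[rotated]
        intro!: balanced_disjoint_union balanced_cycle_graph
          balanced_digraph_node_quotient[OF _ node_quotient_identify_nodes])

section \<open>Realising a quotient by construction steps\<close>

lemma obtained_from_cycle_iff:
  "obtained_from_cycle X \<longleftrightarrow>
     (\<exists>n H. construction_step\<^sup>*\<^sup>* (cycle_graph n) H \<and> digraph_iso X H)"
  unfolding obtained_from_cycle_def rtranclp_power relpowp_fun_conv by metis

text \<open>
  The merged node \<open>{u, v}\<close> is represented by \<open>u\<close>, so that no new node names are needed.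
\<close>
lemma construction_step_merge:
  assumes G: "wf_digraph G" and uv: "u \<in> verts G" "v \<in> verts G" "u \<noteq> v"
    and q: "node_quotient (\<lambda>x. if x = v then u else x) id G H"
  shows "construction_step G H"
proof (rule construction_step.identify[OF uv])
  interpret G: wf_digraph G by fact
  let ?r = "\<lambda>x. if x = v then u else x"
  let ?c = "\<lambda>x. identification G u v `` {x}"
  \<comment> \<open>\<open>?c\<close> and \<open>?r\<close> merge the same nodes, so
    \<open>?c\<close> becomes injective on the representatives, which are the nodes of
    \<open>H\<close>.\<close>
  have c: "?c x = ?c y \<longleftrightarrow> ?r x = ?r y" if "x \<in> verts G" "y \<in> verts G" for x y
    using that uv
    by (subst eq_equiv_class_iff[OF equiv_identification[OF uv(1,2)]])
       (auto simp: identification_def doubleton_eq_iff)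
  have H: "verts H = ?r ` verts G" "arcs H = arcs G"
    "\<And>a. a \<in> arcs G \<Longrightarrow> tail H a = ?r (tail G a)" "\<And>a. a \<in> arcs G \<Longrightarrow> head H a = ?r (head G a)"
    using q by (auto simp: node_quotient_def bij_betw_def)
  have r: "?r x \<in> verts G" "?c (?r x) = ?c x" if "x \<in> verts G" for x
    using that uv c[of "?r x" x] by auto
  \<comment> \<open>The isomorphism is built from \<open>H\<close> to the quotient, sending a
    representative to its class; the other direction would require choosing representatives.\<close>
  have "wf_digraph H"
    by unfold_locales (auto simp: H)
  moreover have "inj_on ?c (verts H)"
    unfolding H(1) using c r uv by (auto simp: inj_on_def split: if_splits)
  moreover have "node_quotient ?c id H (identify_nodes G u v)"
  proof -
    have "?c ` verts H = ?c ` verts G"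
      unfolding H(1) image_image by (rule image_cong[OF refl]) (rule r)
    also have "\<dots> = verts (identify_nodes G u v)"
      by (auto simp: identify_nodes_def quotient_def)
    finally show ?thesis
      using r(2) by (simp add: node_quotient_def identify_nodes_def H)
  qed
  ultimately have "digraph_iso H (identify_nodes G u v)"
    unfolding digraph_iso_iff_node_quotient by blast
  then show "digraph_iso (identify_nodes G u v) H"
    by (rule digraph_iso_sym)
qed

text \<open>Induction on the number of nodes: if \<open>f\<close> is injective, it is already part
  of an isomorphism; otherwise two nodes with the same image are merged, and \<open>f\<close> still
  maps the smaller graph onto \<open>X\<close>.\<close>

lemma construction_steps_node_quotient:
  assumes "fin_digraph G" "node_quotient f g G X"
  shows "\<exists>H. construction_step\<^sup>*\<^sup>* G H \<and> digraph_iso X H"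
  using assms
proof (induction "card (verts G)" arbitrary: G rule: less_induct)
  case less
  interpret G: fin_digraph G by fact
  show ?case
  proof (cases "inj_on f (verts G)")
    case True
    with less.prems have "digraph_iso G X"
      unfolding digraph_iso_iff_node_quotient using G.wf_digraph_axioms by blast
    then show ?thesis by (blast intro: digraph_iso_sym)
  next
    case False
    then obtain u v where uv: "u \<in> verts G" "v \<in> verts G" "u \<noteq> v" and f: "f u = f v"
      by (auto simp: inj_on_def)
    let ?r = "\<lambda>x. if x = v then u else x"
    define G' where "G' = \<lparr>verts = ?r ` verts G, arcs = arcs G,
      tail = ?r \<circ> tail G, head = ?r \<circ> head G\<rparr>"
    have "node_quotient ?r id G G'"
      by (auto simp: node_quotient_def G'_def)
    then have step: "construction_step G G'"
      using uv G.wf_digraph_axioms by (intro construction_step_merge)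
    have "verts G' = verts G - {v}"
      using uv by (auto simp: G'_def)
    then have "card (verts G') < card (verts G)"
      using uv by (simp add: card_Diff1_less del: card_Diff_insert card_Diff_singleton)
    moreover have "fin_digraph G'"
      by unfold_locales (auto simp: G'_def)
    moreover have "node_quotient f g G' X"
    proof -
      \<comment> \<open>As \<open>f u = f v\<close>, replacing \<open>v\<close> by \<open>u\<close>
        is invisible to \<open>f\<close>, so the same \<open>f\<close> and \<open>g\<close> work for
        \<open>G'\<close>.\<close>
      have fr: "f (?r x) = f x" for x
        using f by simp
      then have "f ` verts G' = f ` verts G"
        unfolding G'_def by (simp only: image_image pre_digraph.simps)
      then show ?thesis
        using less.prems(2) by (simp add: node_quotient_def G'_def fr)
    qed
    ultimately obtain H where "construction_step\<^sup>*\<^sup>* G' H" "digraph_iso X H"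
      using less.hyps by blast
    with step show ?thesis by (blast intro: converse_rtranclp_into_rtranclp)
  qed
qed

section \<open>Euler circuits as quotients of cycles\<close>

lemma (in pre_digraph) cas_nth:
  assumes "cas u p v" "i < length p"
  shows "head G (p ! i) = (if Suc i < length p then tail G (p ! Suc i) else v)"
  using assms
proof (induction p arbitrary: u i)
  case (Cons a p)
  then show ?case by (cases i; cases p) auto
qed simp

text \<open>Arc \<open>i\<close> of the cycle goes to the \<open>i\<close>-th arc of the circuit and
  node \<open>i\<close> to the tail of that arc. The arc map is bijective because the circuit uses
  every arc exactly once.\<close>

lemma (in wf_digraph) node_quotient_euler_trail:
  assumes "euler_trail u p u"
  shows "\<exists>f g. node_quotient f g (cycle_graph (length p)) G"
proof -
  have w: "awalk u p u" and d: "distinct p" and p: "set p = arcs G"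
    and v: "set (awalk_verts u p) = verts G"
    using assms by (auto simp: euler_trail_def trail_def)
  have cas: "cas u p u" using w by (simp add: awalk_def)
  let ?n = "length p"
  show ?thesis
  proof (cases "p = []")
    case True
    \<comment> \<open>The empty circuit forces \<open>G\<close> to be the single node
      \<open>u\<close> without arcs, the image of \<open>c_0\<close>; the arc map has empty domain,
      so its value is arbitrary.\<close>
    then have "node_quotient (\<lambda>_. u) (\<lambda>_. undefined) (cycle_graph ?n) G"
      using p v by (auto simp: node_quotient_def cycle_graph_def bij_betw_def)
    then show ?thesis by blast
  next
    case False
    then have u: "u = tail G (p ! 0)"
      using cas by (cases p) auto
    \<comment> \<open>Closedness of the circuit gives the wrap-around: the last arc ends at
      \<open>u\<close>, the tail of arc 0.\<close>
    have hd: "head G (p ! i) = tail G (p ! (Suc i mod ?n))" if "i < ?n" for i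
      using cas_nth[OF cas that] that u by (cases "Suc i = ?n") auto
    have "bij_betw ((!) p) {..<?n} (arcs G)"
      using bij_betw_nth[OF d] p by simp
    moreover have "(\<lambda>i. tail G (p ! i)) ` {..<?n} = verts G"
    proof -
      have "verts G = {u} \<union> tail G ` set p \<union> head G ` set p"
        using v set_awalk_verts[OF w] by simp
      also have "\<dots> = tail G ` set p"
      proof -
        have "u \<in> tail G ` set p"
          using False u by (simp add: imageI)
        \<comment> \<open>Each head is the tail of the cyclically next arc, so the tails alone cover
          all nodes visited.\<close>
        moreover have "head G a \<in> tail G ` set p" if "a \<in> set p" for a
          using that False hd by (auto simp: in_set_conv_nth[of a] intro!: imageI nth_mem)
        ultimately show ?thesis by blast
      qed
      also have "\<dots> = (\<lambda>i. tail G (p ! i)) ` {..<?n}"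
        by (force simp: in_set_conv_nth)
      finally show ?thesis ..
    qed
    ultimately have "node_quotient (\<lambda>i. tail G (p ! i)) ((!) p) (cycle_graph ?n) G"
      using False hd by (auto simp: node_quotient_def cycle_graph_def)
    then show ?thesis by blast
  qed
qed

theorem theorem4p3:
  fixes X :: "('a, 'b) pre_digraph"
  assumes "fin_digraph X"
    and "verts X \<noteq> {}"
    and "zigzag_connected X"
  shows "obtained_from_cycle X \<longleftrightarrow> (\<forall>x\<in>verts X. in_degree X x = out_degree X x)"
proof
  assume "obtained_from_cycle X"
  then obtain n H where "construction_step\<^sup>*\<^sup>* (cycle_graph n) H" and iso: "digraph_iso X H"
    unfolding obtained_from_cycle_iff by blast
  from this(1) have "balanced_digraph H"
    by (induction rule: rtranclp_induct) (auto intro: balanced_cycle_graph balanced_construction_step)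
  then have "balanced_digraph X"
    using iso by (blast intro: balanced_digraph_iso digraph_iso_sym)
  then show "\<forall>x\<in>verts X. in_degree X x = out_degree X x"
    by (simp add: balanced_digraph_def)
next
  interpret fin_digraph X by fact
  assume "\<forall>x\<in>verts X. in_degree X x = out_degree X x"
  moreover have "connected X"
    \<comment> \<open>Nonemptiness enters here, since \<open>connected\<close> excludes the graph
      without nodes; Euler's theorem then supplies the circuit.\<close>
    using assms connected_iff_zigzag_connected[OF wf_digraph_axioms] by simp
  ultimately obtain u p where "euler_trail u p u"
    using closed_euler1 by blast
  then obtain f g where "node_quotient f g (cycle_graph (length p)) X"
    using node_quotient_euler_trail by blast
  moreover have "fin_digraph (cycle_graph (length p))"
    using balanced_cycle_graph by (simp add: balanced_digraph_def)
  ultimately show "obtained_from_cycle X"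
    unfolding obtained_from_cycle_iff using construction_steps_node_quotient by blast
qed

end
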